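(* For sets without proper arithmetic progressions of length $4$ the following exact values hold: $r_4(\mathbb{Z}_4^1)=3$, $r_4(\mathbb{Z}_4^2)=10$, $r_4(\mathbb{Z}_4^3)=36$, and $r_4(\mathbb{Z}_4^4)=128$.
   Context: $\mathbb{Z}_m^n$ denotes the additive group $(\mathbb{Z}/m\mathbb{Z})^n$. A proper arithmetic progression of length $k$ in $\mathbb{Z}_m^n$ is a sequence $x, x+d, \ldots, x+(k-1)d$ (with $x,d\in\mathbb{Z}_m^n$) whose $k$ elements are pairwise distinct. $r_k(\mathbb{Z}_m^n)$ denotes the maximal size of a set $S\subseteq\mathbb{Z}_m^n$ that does not contain a proper arithmetic progression of length $k$. *)

theory Defs
  imports "HOL-Algebra.Product_Groups"
begin

definition Z_power :: "nat \<Rightarrow> nat \<Rightarrow> (nat \<Rightarrow> int) monoid" where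
  "Z_power m n = product_group {..<n} (\<lambda>_. integer_mod_group m)"

text \<open>
  The group operation of \<open>integer_mod_group m\<close> is addition modulo \<open>m\<close>, so the term below is
  the additive \<open>x + i d\<close>.
\<close>

definition ap_term :: "('a, 'b) monoid_scheme \<Rightarrow> 'a \<Rightarrow> 'a \<Rightarrow> nat \<Rightarrow> 'a" where
  "ap_term G x d i = x \<otimes>\<^bsub>G\<^esub> d [^]\<^bsub>G\<^esub> i"

definition contains_proper_ap :: "('a, 'b) monoid_scheme \<Rightarrow> nat \<Rightarrow> 'a set \<Rightarrow> bool" where
  "contains_proper_ap G k S \<longleftrightarrow>
     (\<exists>x\<in>carrier G. \<exists>d\<in>carrier G.
        inj_on (ap_term G x d) {..<k} \<and> ap_term G x d ` {..<k} \<subseteq> S)"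

text \<open>
  The maximum is over a finite nonempty set whenever \<open>m > 0\<close> and \<open>k > 0\<close>.
  The definition is intended only for such parameters.
\<close>

definition r_ap :: "nat \<Rightarrow> nat \<Rightarrow> nat \<Rightarrow> nat" where
  "r_ap k m n =
     Max {card S | S. S \<subseteq> carrier (Z_power m n) \<and> \<not> contains_proper_ap (Z_power m n) k S}"

end

theory Submission
  imports Defs
begin

text \<open>
  Write a point of \<open>Z_4^n\<close> as \<open>a + 2u\<close> with \<open>a\<close>, \<open>u\<close> in \<open>Z_2^n\<close>. A progression with an odd difference
  consists of two pairs with difference \<open>a + b\<close>, one in the fibre over \<open>a\<close> and one in the fibre over
  \<open>b\<close>, so \<open>S\<close> contains no proper progression iff for all \<open>a \<noteq> b\<close> the vector \<open>a + b\<close> is a ``gap'',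
  that is, not a difference, of one of the two fibres. A fibre \<open>A\<close> has at most \<open>2^n - |A|\<close> gaps, and
  every one of the \<open>2^n (2^n - 1) / 2\<close> pairs needs one, so
  \<open>|S| \<le> 4^n - 2^n (2^n - 1) / 2\<close>, which is sharp for \<open>n \<le> 3\<close>.

  For \<open>n = 4\<close> this gives only 136. If \<open>|S| > 128\<close>, then one fibre, over 0 say, has more than eight
  elements and hence no gaps, and at most one other fibre, over \<open>c\<close>, has fewer than five. For
  \<open>b \<noteq> 0, c\<close> the gaps over \<open>b\<close> form a sum-free set that contains \<open>b\<close>. Counting inside
  the index two subgroups that avoid \<open>c\<close> is tight; it forces the gaps over \<open>b\<close> to lie where a linear
  functional \<open>g_b\<close> is 1, with \<open>g_a(b) + g_b(a) = 1\<close> whenever \<open>a\<close>, \<open>b\<close>, \<open>c\<close> are independent, and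
  these relations are contradictory.
\<close>

section \<open>Fibres over the residues modulo two\<close>

unbundle bit_operations_syntax

text \<open>Vectors in \<open>Z_2^n\<close> are the numbers below \<open>2 ^ n\<close>, added by \<open>XOR\<close>.\<close>

lemma xor_cancel_left [simp]: "x XOR (x XOR y) = (y::nat)"
  by (simp flip: xor.assoc)

lemma xor_eq_0_iff [simp]: "x XOR y = 0 \<longleftrightarrow> x = (y::nat)"
  by (metis xor_cancel_left xor_self_eq)

lemma xor_pos_iff [simp]: "0 < x XOR y \<longleftrightarrow> x \<noteq> (y::nat)"
  by (simp flip: neq0_conv)

lemma xor_eq_left_iff [simp]: "x XOR y = x \<longleftrightarrow> y = (0::nat)" "x = x XOR y \<longleftrightarrow> y = 0"
  by (metis xor_cancel_left xor_self_eq)+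

lemma xor_eq_right_iff [simp]: "x XOR y = y \<longleftrightarrow> x = (0::nat)" "y = x XOR y \<longleftrightarrow> x = 0"
  by (metis xor_eq_left_iff xor.commute)+

lemma xor_cancel_right [simp]: "(y XOR x) XOR x = (y::nat)"
  by (simp add: xor.assoc)

lemma xor_less_power_two: "x XOR y < 2 ^ n" if "x < 2 ^ n" "y < 2 ^ n" for x y :: nat
  using that by (metis take_bit_nat_eq_self take_bit_nat_less_exp take_bit_xor)

lemma not_bit_if_less: "\<not> bit (a::nat) j" if "a < 2 ^ n" "n \<le> j"
  using that by (metis bit_take_bit_iff not_le take_bit_nat_eq_self)

definition residue :: "nat \<Rightarrow> nat \<Rightarrow> nat \<Rightarrow> int" where
  "residue a u j = of_bool (bit a j) + 2 * of_bool (bit u j)"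

definition point :: "nat \<Rightarrow> nat \<Rightarrow> nat \<Rightarrow> nat \<Rightarrow> int" where
  "point n a u = restrict (residue a u) {..<n}"

definition fibre :: "nat \<Rightarrow> (nat \<Rightarrow> int) set \<Rightarrow> nat \<Rightarrow> nat set" where
  "fibre n S a = {u. u < 2 ^ n \<and> point n a u \<in> S}"

lemma carrier_Z4: "carrier (Z_power 4 n) = (\<Pi>\<^sub>E j\<in>{..<n}. {0..<4})"
  by (simp add: Z_power_def carrier_integer_mod_group)

lemma point_in_carrier: "point n a u \<in> carrier (Z_power 4 n)"
  by (auto simp: carrier_Z4 point_def residue_def)

lemma residue_mod_4 [simp]: "residue a u j mod 4 = residue a u j"
  by (auto simp: residue_def)

lemma residue_eq_iff:
  "residue a u j = residue b v j \<longleftrightarrow> (bit a j \<longleftrightarrow> bit b j) \<and> (bit u j \<longleftrightarrow> bit v j)"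
  by (auto simp: residue_def)

lemma point_eqD:
  assumes "point n a u = point n b v" "a < 2 ^ n" "b < 2 ^ n" "u < 2 ^ n" "v < 2 ^ n"
  shows "a = b \<and> u = v"
proof -
  have *: "(bit a j \<longleftrightarrow> bit b j) \<and> (bit u j \<longleftrightarrow> bit v j)" for j
  proof (cases "j < n")
    case True
    then have "residue a u j = residue b v j"
      using fun_cong[OF assms(1), of j] by (simp add: point_def)
    then show ?thesis by (simp add: residue_eq_iff)
  next
    case False
    then show ?thesis using assms(2-) not_bit_if_less by (meson leI)
  qed
  then show ?thesis by (auto intro!: bit_eqI)
qed

lemma bij_betw_point:
  "bij_betw (\<lambda>(a, u). point n a u) ({..<2 ^ n} \<times> {..<2 ^ n}) (carrier (Z_power 4 n))"
proof -
  have inj: "inj_on (\<lambda>(a, u). point n a u) ({..<2 ^ n} \<times> {..<2 ^ n})"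
    using point_eqD by (fastforce simp: inj_on_def)
  have fin: "finite (carrier (Z_power 4 n))"
    by (simp add: carrier_Z4 finite_PiE)
  have "card (carrier (Z_power 4 n)) = 4 ^ n"
    by (simp add: carrier_Z4 card_PiE)
  also have "\<dots> = card ({..<2 ^ n :: nat} \<times> {..<2 ^ n :: nat})"
    by (simp add: card_cartesian_product flip: power_mult_distrib)
  also have "\<dots> = card ((\<lambda>(a, u). point n a u) ` ({..<2 ^ n} \<times> {..<2 ^ n}))"
    by (rule card_image[OF inj, symmetric])
  finally have "(\<lambda>(a, u). point n a u) ` ({..<2 ^ n} \<times> {..<2 ^ n}) = carrier (Z_power 4 n)"
    using point_in_carrier by (intro card_subset_eq[OF fin]) auto
  with inj show ?thesis by (simp add: bij_betw_def)
qed

lemma carrier_pointE: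
  assumes "x \<in> carrier (Z_power 4 n)"
  obtains a u where "a < 2 ^ n" "u < 2 ^ n" "x = point n a u"
  using assms bij_betw_imp_surj_on[OF bij_betw_point[of n]] by force

lemma card_eq_sum_fibres:
  assumes "S \<subseteq> carrier (Z_power 4 n)"
  shows "card S = (\<Sum>a<2 ^ n. card (fibre n S a))"
proof -
  let ?f = "\<lambda>(a, u). point n a u"
  let ?T = "Sigma {..<2 ^ n} (fibre n S)"
  have "?T \<subseteq> {..<2 ^ n} \<times> {..<2 ^ n}"
    by (auto simp: fibre_def)
  then have inj: "inj_on ?f ?T"
    using bij_betw_point[of n] by (meson bij_betw_imp_inj_on inj_on_subset)
  have "?f ` ?T = S"
  proof
    show "?f ` ?T \<subseteq> S" by (auto simp: fibre_def)
    show "S \<subseteq> ?f ` ?T"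
    proof
      fix x assume "x \<in> S"
      with assms obtain a u where "a < 2 ^ n" "u < 2 ^ n" "x = point n a u"
        by (meson carrier_pointE subsetD)
      with \<open>x \<in> S\<close> show "x \<in> ?f ` ?T"
        by (force simp: fibre_def)
    qed
  qed
  then have "card S = card ?T"
    using card_image[OF inj] by simp
  also have "\<dots> = (\<Sum>a<2 ^ n. card (fibre n S a))"
    by (rule card_SigmaI) (auto simp: fibre_def)
  finally show ?thesis .
qed

lemma one_integer_mod_group: "\<one>\<^bsub>integer_mod_group m\<^esub> = 0"
  by (simp add: integer_mod_group_def)

lemma mult_Z4:
  "x \<otimes>\<^bsub>Z_power 4 n\<^esub> y = (\<lambda>j\<in>{..<n}. (x j + y j) mod 4)"
  by (simp add: Z_power_def cong: restrict_cong)

lemma ap_term_Z4: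
  assumes "x \<in> carrier (Z_power 4 n)" "d \<in> carrier (Z_power 4 n)"
  shows "ap_term (Z_power 4 n) x d i = (\<lambda>j\<in>{..<n}. (x j + int i * d j) mod 4)"
proof -
  let ?G = "Z_power 4 n"
  have pow: "d [^]\<^bsub>?G\<^esub> i = (\<lambda>j\<in>{..<n}. (int i * d j) mod 4)"
  proof (induction i)
    case 0
    show ?case
      by (auto simp: Z_power_def nat_pow_def product_group_def one_integer_mod_group)
  next
    case (Suc i)
    have "d [^]\<^bsub>?G\<^esub> Suc i = d [^]\<^bsub>?G\<^esub> i \<otimes>\<^bsub>?G\<^esub> d"
      by (simp add: nat_pow_def)
    also have "\<dots> = (\<lambda>j\<in>{..<n}. ((int i * d j) mod 4 + d j) mod 4)"
      by (simp add: Suc mult_Z4 cong: restrict_cong)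
    finally show ?case
      by (simp add: mod_simps algebra_simps cong: restrict_cong)
  qed
  show ?thesis
    by (simp add: ap_term_def pow mult_Z4 mod_add_right_eq cong: restrict_cong)
qed

lemma ap_term_point:
  assumes "d \<in> carrier (Z_power 4 n)"
  shows "ap_term (Z_power 4 n) (point n a u) d i =
    (\<lambda>j\<in>{..<n}. (residue a u j + int i * d j) mod 4)"
  unfolding ap_term_Z4[OF point_in_carrier assms] by (simp add: point_def cong: restrict_cong)

lemma range_4: "{..<4::nat} = {0, 1, 2, 3}"
  by auto

lemma binary_double_step:
  fixes d :: int
  assumes "of_bool B + 2 * of_bool V = (of_bool A + 2 * of_bool U + d) mod 4" "0 \<le> d" "d < 4"
  shows "of_bool A + 2 * of_bool (U \<noteq> (A \<noteq> B)) = (of_bool A + 2 * of_bool U + 2 * d) mod 4 \<and>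
    of_bool B + 2 * of_bool (V \<noteq> (A \<noteq> B)) = (of_bool A + 2 * of_bool U + 3 * d) mod 4"
proof -
  have "d \<in> {0, 1, 2, 3}" using assms(2,3) by auto
  then show ?thesis using assms(1)
    by (cases A; cases B; cases U; cases V) auto
qed

lemma residue_double_step:
  assumes "residue b v j = (residue a u j + d) mod 4" "0 \<le> d" "d < 4"
  shows "residue a (u XOR (a XOR b)) j = (residue a u j + 2 * d) mod 4 \<and>
    residue b (v XOR (a XOR b)) j = (residue a u j + 3 * d) mod 4"
  using assms unfolding residue_def bit_xor_iff by (rule binary_double_step)

lemma ap_terms_from_two:
  assumes "ap_term (Z_power 4 n) (point n a u) d 1 = point n b v" "d \<in> carrier (Z_power 4 n)"
  shows "ap_term (Z_power 4 n) (point n a u) d 2 = point n a (u XOR (a XOR b))"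
    and "ap_term (Z_power 4 n) (point n a u) d 3 = point n b (v XOR (a XOR b))"
proof -
  note ap = ap_term_point[OF assms(2)]
  have *: "residue a (u XOR (a XOR b)) j = (residue a u j + 2 * d j) mod 4 \<and>
    residue b (v XOR (a XOR b)) j = (residue a u j + 3 * d j) mod 4" if "j < n" for j
  proof (rule residue_double_step)
    have "(\<lambda>j\<in>{..<n}. (residue a u j + int 1 * d j) mod 4) j = point n b v j"
      unfolding ap[symmetric] assms(1) ..
    then show "residue b v j = (residue a u j + d j) mod 4"
      using that by (simp add: point_def)
    have "d j \<in> {0..<4}"
      using PiE_mem[of d "{..<n}" "\<lambda>_. {0..<4}" j] assms(2) that by (simp add: carrier_Z4)
    then show "0 \<le> d j" "d j < 4" by auto
  qed
  show "ap_term (Z_power 4 n) (point n a u) d 2 = point n a (u XOR (a XOR b))"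
    unfolding ap unfolding point_def by (rule restrict_ext) (use * in simp)
  show "ap_term (Z_power 4 n) (point n a u) d 3 = point n b (v XOR (a XOR b))"
    unfolding ap unfolding point_def by (rule restrict_ext) (use * in simp)
qed

lemma contains_proper_ap_Z4_iff:
  assumes "S \<subseteq> carrier (Z_power 4 n)"
  shows "contains_proper_ap (Z_power 4 n) 4 S \<longleftrightarrow>
    (\<exists>a<2 ^ n. \<exists>b<2 ^ n. a \<noteq> b \<and>
       (\<exists>u\<in>fibre n S a. u XOR (a XOR b) \<in> fibre n S a) \<and>
       (\<exists>v\<in>fibre n S b. v XOR (a XOR b) \<in> fibre n S b))"
    (is "_ \<longleftrightarrow> ?R")
proof
  let ?G = "Z_power 4 n"
  assume "contains_proper_ap ?G 4 S"
  then obtain x d where x: "x \<in> carrier ?G" and d: "d \<in> carrier ?G"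
    and inj: "inj_on (ap_term ?G x d) {..<4}" and S: "ap_term ?G x d ` {..<4} \<subseteq> S"
    by (auto simp: contains_proper_ap_def)
  obtain a u where au: "a < 2 ^ n" "u < 2 ^ n" "x = point n a u"
    using x by (rule carrier_pointE)
  have "ap_term ?G x d 1 \<in> carrier ?G"
    using subsetD[OF assms subsetD[OF S imageI[of 1]]] by simp
  then obtain b v where bv: "b < 2 ^ n" "v < 2 ^ n" "ap_term ?G x d 1 = point n b v"
    by (rule carrier_pointE)
  have t0: "ap_term ?G x d 0 = point n a u"
    unfolding au(3) ap_term_point[OF d] by (simp add: point_def cong: restrict_cong)
  have t2: "ap_term ?G x d 2 = point n a (u XOR (a XOR b))"
    and t3: "ap_term ?G x d 3 = point n b (v XOR (a XOR b))"
    using ap_terms_from_two[of n a u d b v] bv(3) d by (auto simp: au(3))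
  have "a \<noteq> b"
  proof
    assume "a = b"
    then have "ap_term ?G x d 0 = ap_term ?G x d 2" using t0 t2 by simp
    then show False using inj by (auto dest: inj_onD)
  qed
  moreover have "u \<in> fibre n S a" "u XOR (a XOR b) \<in> fibre n S a"
    "v \<in> fibre n S b" "v XOR (a XOR b) \<in> fibre n S b"
    using S au(1,2) bv by (auto simp: fibre_def range_4 xor_less_power_two simp flip: t0 t2 t3)
  ultimately show ?R using au bv by blast
next
  let ?G = "Z_power 4 n"
  assume ?R
  then obtain a b u v where ab: "a < 2 ^ n" "b < 2 ^ n" "a \<noteq> b"
    and F: "u \<in> fibre n S a" "u XOR (a XOR b) \<in> fibre n S a"
      "v \<in> fibre n S b" "v XOR (a XOR b) \<in> fibre n S b"
    by blast
  define x where "x = point n a u"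
  define d where "d = (\<lambda>j\<in>{..<n}. (residue b v j - residue a u j) mod 4)"
  have x: "x \<in> carrier ?G" by (simp add: x_def point_in_carrier)
  have d: "d \<in> carrier ?G" by (auto simp: d_def carrier_Z4)
  have t0: "ap_term ?G x d 0 = point n a u"
    unfolding x_def ap_term_point[OF d] by (simp add: point_def cong: restrict_cong)
  have t1: "ap_term ?G x d 1 = point n b v"
    unfolding x_def ap_term_point[OF d]
    by (simp add: d_def point_def mod_simps cong: restrict_cong)
  have t2: "ap_term ?G x d 2 = point n a (u XOR (a XOR b))"
    and t3: "ap_term ?G x d 3 = point n b (v XOR (a XOR b))"
    using ap_terms_from_two[of n a u d b v] t1 d by (auto simp: x_def)
  have uv: "u < 2 ^ n" "v < 2 ^ n" "u XOR (a XOR b) < 2 ^ n" "v XOR (a XOR b) < 2 ^ n"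
    using F by (auto simp: fibre_def)
  have ne: "u XOR (a XOR b) \<noteq> u" "v XOR (a XOR b) \<noteq> v"
    using ab(3) by (metis xor_cancel_left xor_self_eq xor_eq_0_iff)+
  have eq: "point n p q = point n p' q' \<longleftrightarrow> p = p' \<and> q = q'"
    if "p < 2 ^ n" "p' < 2 ^ n" "q < 2 ^ n" "q' < 2 ^ n" for p q p' q'
    using that point_eqD by blast
  have "inj_on (ap_term ?G x d) {0, 1, 2, 3}"
    unfolding inj_on_insert using ab(3) ab(3)[symmetric] ne ne[symmetric]
    by (simp add: t0 t1 t2 t3 eq ab uv del: One_nat_def)
  moreover have "ap_term ?G x d ` {0, 1, 2, 3} \<subseteq> S"
    using F by (simp add: t0 t1 t2 t3 fibre_def del: One_nat_def)
  ultimately show "contains_proper_ap ?G 4 S"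
    using x d unfolding contains_proper_ap_def range_4 by blast
qed

section \<open>Gaps and the counting bound\<close>

lemma inj_xor: "inj_on (\<lambda>x. a XOR x) (A :: nat set)"
  by (rule inj_on_inverseI[where g = "\<lambda>x. a XOR x"]) simp

lemma bij_betw_xor: "bij_betw (\<lambda>x. a XOR x) {..<2 ^ n} {..<2 ^ n}" if "a < 2 ^ n" for a :: nat
  by (rule bij_betw_byWitness[where f' = "\<lambda>x. a XOR x"]) (use that xor_less_power_two in auto)

definition gaps :: "nat \<Rightarrow> nat set \<Rightarrow> nat set" where
  "gaps n A = {e. e < 2 ^ n \<and> e \<noteq> 0 \<and> (\<forall>u\<in>A. u XOR e \<notin> A)}"

definition admissible :: "nat \<Rightarrow> (nat \<Rightarrow> nat set) \<Rightarrow> bool" where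
  "admissible n A \<longleftrightarrow> (\<forall>a<2 ^ n. A a \<subseteq> {..<2 ^ n}) \<and>
     (\<forall>a<2 ^ n. \<forall>b<2 ^ n. a \<noteq> b \<longrightarrow> a XOR b \<in> gaps n (A a) \<union> gaps n (A b))"

lemma not_contains_iff_admissible:
  assumes "S \<subseteq> carrier (Z_power 4 n)"
  shows "\<not> contains_proper_ap (Z_power 4 n) 4 S \<longleftrightarrow> admissible n (fibre n S)"
proof -
  have "fibre n S a \<subseteq> {..<2 ^ n}" for a by (auto simp: fibre_def)
  moreover have "a XOR b \<in> gaps n (fibre n S a) \<union> gaps n (fibre n S b) \<longleftrightarrow>
     \<not> ((\<exists>u\<in>fibre n S a. u XOR (a XOR b) \<in> fibre n S a) \<and>
        (\<exists>v\<in>fibre n S b. v XOR (a XOR b) \<in> fibre n S b))"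
    if "a < 2 ^ n" "b < 2 ^ n" "a \<noteq> b" for a b
    using that xor_less_power_two[of a n b] xor_eq_0_iff[of a b] unfolding gaps_def by blast
  ultimately show ?thesis
    unfolding contains_proper_ap_Z4_iff[OF assms] admissible_def by blast
qed

lemma fibre_union_points:
  assumes "\<And>a. a < 2 ^ n \<Longrightarrow> A a \<subseteq> {..<2 ^ n}" "a < 2 ^ n"
  shows "fibre n {point n b u | b u. b < 2 ^ n \<and> u \<in> A b} a = A a"
proof
  let ?S = "{point n b u | b u. b < 2 ^ n \<and> u \<in> A b}"
  show "A a \<subseteq> fibre n ?S a"
    using assms by (auto simp: fibre_def)
  show "fibre n ?S a \<subseteq> A a"
  proof
    fix u assume "u \<in> fibre n ?S a"
    then obtain b v where "u < 2 ^ n" "b < 2 ^ n" "v \<in> A b" "point n a u = point n b v"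
      by (auto simp: fibre_def)
    moreover from this assms(1) have "v < 2 ^ n" by blast
    ultimately show "u \<in> A a" using point_eqD assms(2) by blast
  qed
qed

lemma r_ap_eqI:
  assumes upper: "\<And>A. admissible n A \<Longrightarrow> (\<Sum>a<2 ^ n. card (A a)) \<le> N"
    and lower: "admissible n A" "(\<Sum>a<2 ^ n. card (A a)) = N"
  shows "r_ap 4 4 n = N"
  unfolding r_ap_def
proof (rule Max_eqI)
  let ?C = "carrier (Z_power 4 n)"
  let ?T = "{card S | S. S \<subseteq> ?C \<and> \<not> contains_proper_ap (Z_power 4 n) 4 S}"
  show le: "k \<le> N" if "k \<in> ?T" for k
    using that upper by (auto simp: card_eq_sum_fibres not_contains_iff_admissible)
  then show "finite ?T" by (meson finite_nat_iff_bounded_le atMost_iff subsetI)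
  let ?S = "{point n b u | b u. b < 2 ^ n \<and> u \<in> A b}"
  have sub: "?S \<subseteq> ?C" using point_in_carrier by auto
  have fib: "fibre n ?S a = A a" if "a < 2 ^ n" for a
    by (rule fibre_union_points) (use lower(1) that in \<open>auto simp: admissible_def\<close>)
  have "admissible n (fibre n ?S)"
    using lower(1) by (simp add: admissible_def fib)
  moreover have "card ?S = N"
    using lower(2) by (simp add: card_eq_sum_fibres[OF sub] fib)
  ultimately show "N \<in> ?T"
    using sub not_contains_iff_admissible by blast
qed

lemma card_add_card_gaps_le:
  assumes "A \<subseteq> {..<2 ^ n}"
  shows "card A + card (gaps n A) \<le> 2 ^ n"
proof (cases "A = {}")
  case True
  then show ?thesis
    using card_mono[of "{..<2 ^ n}" "gaps n A"] by (auto simp: gaps_def)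
next
  case False
  then obtain a where a: "a \<in> A" by blast
  let ?B = "(\<lambda>x. a XOR x) ` gaps n A"
  have "A \<inter> ?B = {}" using a by (auto simp: gaps_def)
  moreover have "A \<union> ?B \<subseteq> {..<2 ^ n}"
    using assms a xor_less_power_two by (auto simp: gaps_def)
  moreover have "finite A" "finite ?B"
    using assms finite_subset by (auto simp: gaps_def)
  ultimately have "card A + card ?B \<le> 2 ^ n"
    using card_mono[of "{..<2 ^ n}" "A \<union> ?B"] by (simp add: card_Un_disjoint)
  then show ?thesis by (simp add: card_image[OF inj_xor])
qed

lemma sum_off_diagonal: "(\<Sum>a\<in>W. \<Sum>b\<in>W. of_bool (a \<noteq> b)) = card W * (card W - 1)"
  if "finite W" for W :: "nat set"
proof -
  have "(\<Sum>b\<in>W. of_bool (a \<noteq> b)) = card W - 1" if "a \<in> W" for a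
  proof -
    have "W \<inter> {b. a \<noteq> b} = W - {a}" by auto
    then show ?thesis using that \<open>finite W\<close> by simp
  qed
  then show ?thesis by simp
qed

lemma sum_card_gaps_ge:
  assumes "admissible n A"
  shows "2 ^ n * (2 ^ n - 1) \<le> 2 * (\<Sum>a<2 ^ n. card (gaps n (A a)))"
proof -
  let ?X = "{..<2 ^ n :: nat}"
  define t :: "nat \<Rightarrow> nat \<Rightarrow> nat" where "t a b = of_bool (a XOR b \<in> gaps n (A a))" for a b
  have t: "(\<Sum>b\<in>?X. t a b) = card (gaps n (A a))" if "a \<in> ?X" for a
  proof -
    have "(\<Sum>b\<in>?X. t a b) = (\<Sum>e\<in>?X. of_bool (e \<in> gaps n (A a)))"
      unfolding t_def
      by (rule sum.reindex_bij_betw[OF bij_betw_xor]) (use that in simp)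
    also have "\<dots> = card (?X \<inter> gaps n (A a))" by (simp add: Int_def)
    also have "?X \<inter> gaps n (A a) = gaps n (A a)" by (auto simp: gaps_def)
    finally show ?thesis .
  qed
  have "2 ^ n * (2 ^ n - 1) = (\<Sum>a\<in>?X. \<Sum>b\<in>?X. of_bool (a \<noteq> b) :: nat)"
    unfolding sum_off_diagonal[OF finite_lessThan] by simp
  also have "\<dots> \<le> (\<Sum>a\<in>?X. \<Sum>b\<in>?X. t a b + t b a)"
    using assms by (intro sum_mono) (auto simp: t_def admissible_def xor.commute)
  also have "\<dots> = (\<Sum>a\<in>?X. \<Sum>b\<in>?X. t a b) + (\<Sum>a\<in>?X. \<Sum>b\<in>?X. t b a)"
    by (simp add: sum.distrib)
  also have "(\<Sum>a\<in>?X. \<Sum>b\<in>?X. t b a) = (\<Sum>a\<in>?X. \<Sum>b\<in>?X. t a b)"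
    by (rule sum.swap)
  finally show ?thesis using t by simp
qed

lemma admissible_sum_card_le:
  assumes "admissible n A"
  shows "2 * (\<Sum>a<2 ^ n. card (A a)) + 2 ^ n * (2 ^ n - 1) \<le> 2 * (2 ^ n * 2 ^ n)"
proof -
  have "(\<Sum>a<2 ^ n. card (A a) + card (gaps n (A a))) \<le> (\<Sum>a<2 ^ n :: nat. 2 ^ n)"
    using assms by (intro sum_mono card_add_card_gaps_le) (auto simp: admissible_def)
  with sum_card_gaps_ge[OF assms] show ?thesis by (simp add: sum.distrib)
qed

definition odd_and :: "nat \<Rightarrow> nat \<Rightarrow> bool" where
  "odd_and m x \<longleftrightarrow> ((bit m 0 \<and> bit x 0) \<noteq> (bit m 1 \<and> bit x 1)) \<noteq>
     ((bit m 2 \<and> bit x 2) \<noteq> (bit m 3 \<and> bit x 3))"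

lemma odd_and_xor: "odd_and m (x XOR y) \<longleftrightarrow> odd_and m x \<noteq> odd_and m y"
  unfolding odd_and_def bit_xor_iff
  by (cases "bit m 0"; cases "bit m 1"; cases "bit m 2"; cases "bit m 3") auto

lemma admissible_hyperplanes:
  assumes "\<And>a b. a < 2 ^ n \<Longrightarrow> b < 2 ^ n \<Longrightarrow> a \<noteq> b \<Longrightarrow>
    odd_and (m a) (a XOR b) \<or> odd_and (m b) (a XOR b)"
  shows "admissible n (\<lambda>a. {u. u < 2 ^ n \<and> \<not> odd_and (m a) u})"
  unfolding admissible_def
proof (intro conjI allI impI)
  fix a b :: nat
  assume ab: "a < 2 ^ n" "b < 2 ^ n" "a \<noteq> b"
  have "a XOR b \<in> gaps n {u. u < 2 ^ n \<and> \<not> odd_and (m c) u}" if "odd_and (m c) (a XOR b)" for c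
    using that ab xor_less_power_two[OF ab(1,2)] by (simp add: gaps_def odd_and_xor)
  with assms[OF ab] show "a XOR b \<in> gaps n {u. u < 2 ^ n \<and> \<not> odd_and (m a) u} \<union>
      gaps n {u. u < 2 ^ n \<and> \<not> odd_and (m b) u}"
    by blast
qed auto

section \<open>Linear functionals and sum-free sets\<close>

definition xor_linear :: "nat \<Rightarrow> (nat \<Rightarrow> bool) \<Rightarrow> bool" where
  "xor_linear n f \<longleftrightarrow> (\<forall>x<2 ^ n. \<forall>y<2 ^ n. f (x XOR y) \<longleftrightarrow> f x \<noteq> f y)"

definition xor_subgroup :: "nat \<Rightarrow> nat set \<Rightarrow> bool" where
  "xor_subgroup n W \<longleftrightarrow> W \<subseteq> {..<2 ^ n} \<and> 0 \<in> W \<and> (\<forall>x\<in>W. \<forall>y\<in>W. x XOR y \<in> W)"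

definition xor_sum_free :: "nat set \<Rightarrow> bool" where
  "xor_sum_free M \<longleftrightarrow> (\<forall>x\<in>M. \<forall>y\<in>M. x XOR y \<notin> M)"

lemma xor_linearD: "xor_linear n f \<Longrightarrow> x < 2 ^ n \<Longrightarrow> y < 2 ^ n \<Longrightarrow> f (x XOR y) \<longleftrightarrow> f x \<noteq> f y"
  by (simp add: xor_linear_def)

lemma xor_linear_0: "xor_linear n f \<Longrightarrow> \<not> f 0"
  using xor_linearD[of n f 0 0] by simp

lemma xor_subgroup_kernel: "xor_linear n f \<Longrightarrow> xor_subgroup n {x. x < 2 ^ n \<and> \<not> f x}"
  using xor_linear_0 by (auto simp: xor_subgroup_def xor_linearD xor_less_power_two)

lemma card_kernel:
  assumes f: "xor_linear n f" and c: "c < 2 ^ n" "f c"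
  shows "2 * card {x. x < 2 ^ n \<and> \<not> f x} = 2 ^ n"
proof -
  let ?V = "{x. x < 2 ^ n \<and> \<not> f x}" and ?U = "{x. x < 2 ^ n \<and> f x}"
  have "bij_betw (\<lambda>x. c XOR x) ?V ?U"
    by (rule bij_betw_byWitness[where f' = "\<lambda>x. c XOR x"])
      (use c xor_linearD[OF f] xor_less_power_two in auto)
  then have "card ?V = card ?U" by (rule bij_betw_same_card)
  moreover have "card (?V \<union> ?U) = card ?V + card ?U"
    by (rule card_Un_disjoint) auto
  moreover have "?V \<union> ?U = {..<2 ^ n}" by auto
  ultimately show ?thesis by simp
qed

text \<open>A subgroup that is maximal among those containing \<open>W\<close> but not \<open>c\<close> has index two.\<close>

lemma separating_functional:
  assumes W: "xor_subgroup n W" and c: "c < 2 ^ n" "c \<notin> W"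
  obtains f where "xor_linear n f" "\<And>w. w \<in> W \<Longrightarrow> \<not> f w" "f c"
proof -
  let ?F = "{V. xor_subgroup n V \<and> W \<subseteq> V \<and> c \<notin> V}"
  have "finite ?F"
    by (rule finite_subset[of _ "Pow {..<2 ^ n}"]) (auto simp: xor_subgroup_def)
  moreover have "W \<in> ?F" using W c by simp
  ultimately have "\<exists>V\<in>?F. W \<subseteq> V \<and> (\<forall>U\<in>?F. V \<subseteq> U \<longrightarrow> V = U)"
    by (rule finite_has_maximal2)
  then obtain V where V: "V \<in> ?F" and max: "\<forall>U\<in>?F. V \<subseteq> U \<longrightarrow> V = U" by blast
  have sub: "xor_subgroup n V" using V by simp
  have c_in: "c XOR x \<in> V" if x: "x < 2 ^ n" "x \<notin> V" for x
  proof -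
    let ?U = "{z. z < 2 ^ n \<and> (z \<in> V \<or> x XOR z \<in> V)}"
    have inV: "p XOR q \<in> V" if "p \<in> V" "q \<in> V" for p q
      using sub that by (simp add: xor_subgroup_def)
    have "xor_subgroup n ?U"
      unfolding xor_subgroup_def
    proof (intro conjI ballI)
      show "0 \<in> ?U" using sub by (simp add: xor_subgroup_def)
      fix p q assume pq: "p \<in> ?U" "q \<in> ?U"
      have "p XOR (x XOR q) = x XOR (p XOR q)" "(x XOR p) XOR q = x XOR (p XOR q)"
        "(x XOR p) XOR (x XOR q) = p XOR q"
        by (simp_all add: ac_simps)
      with pq inV[of p q] inV[of p "x XOR q"] inV[of "x XOR p" q] inV[of "x XOR p" "x XOR q"]
      have "p XOR q \<in> V \<or> x XOR (p XOR q) \<in> V" by auto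
      with pq show "p XOR q \<in> ?U" by (simp add: xor_less_power_two)
    qed auto
    moreover have "x \<in> ?U" "V \<subseteq> ?U" using sub x by (auto simp: xor_subgroup_def)
    ultimately have "c \<in> ?U" using V max x by blast
    then show ?thesis using V by (simp add: xor.commute)
  qed
  have "xor_linear n (\<lambda>x. x \<notin> V)"
    unfolding xor_linear_def
  proof (intro allI impI)
    fix x y :: nat assume xy: "x < 2 ^ n" "y < 2 ^ n"
    have inV: "p XOR q \<in> V" if "p \<in> V" "q \<in> V" for p q
      using sub that by (simp add: xor_subgroup_def)
    have "x XOR y \<in> V" if "x \<notin> V" "y \<notin> V"
      using inV[OF c_in[OF xy(1) that(1)] c_in[OF xy(2) that(2)]] by (simp add: ac_simps)
    moreover have "x \<in> V" if "x XOR y \<in> V" "y \<in> V" using inV[OF that] by (simp add: ac_simps)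
    moreover have "y \<in> V" if "x XOR y \<in> V" "x \<in> V"
      using inV[OF that] by (simp add: ac_simps)
    ultimately show "(x XOR y \<notin> V) = ((x \<notin> V) \<noteq> (y \<notin> V))" using inV by blast
  qed
  then show thesis by (rule that) (use V in auto)
qed

lemma card_xor_sum_free:
  assumes "finite V" "\<And>x y. x \<in> V \<Longrightarrow> y \<in> V \<Longrightarrow> x XOR y \<in> V" "xor_sum_free M" "M \<subseteq> V"
  shows "2 * card M \<le> card V"
proof (cases "M = {}")
  case False
  then obtain m where m: "m \<in> M" by blast
  let ?B = "(\<lambda>x. m XOR x) ` M"
  have "M \<inter> ?B = {}" using assms(3) m by (auto simp: xor_sum_free_def)
  moreover have "M \<union> ?B \<subseteq> V" using assms(2,4) m by auto
  moreover have "finite M" using assms finite_subset by blast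
  ultimately have "card M + card ?B \<le> card V"
    using card_mono[OF assms(1), of "M \<union> ?B"] by (simp add: card_Un_disjoint)
  then show ?thesis by (simp add: card_image[OF inj_xor])
qed simp

lemma xor_sum_free_half:
  assumes V: "finite V" "\<And>x y. x \<in> V \<Longrightarrow> y \<in> V \<Longrightarrow> x XOR y \<in> V"
    and N: "xor_sum_free N" "N \<subseteq> V" "2 * card N = card V"
    and xy: "x \<in> V" "y \<in> V"
  shows "x XOR y \<in> N \<longleftrightarrow> (x \<in> N) \<noteq> (y \<in> N)"
proof -
  have fin: "finite N" using V(1) N(2) finite_subset by blast
  have complement: "V - N = (\<lambda>z. m XOR z) ` N" if "m \<in> N" for m
  proof (rule card_subset_eq[symmetric])
    show "finite (V - N)" using V(1) by simp
    show "(\<lambda>z. m XOR z) ` N \<subseteq> V - N"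
      using V(2) N(1) subsetD[OF N(2)] that by (auto simp: xor_sum_free_def)
    show "card ((\<lambda>z. m XOR z) ` N) = card (V - N)"
      using N(2,3) fin by (simp add: card_image[OF inj_xor] card_Diff_subset)
  qed
  have mixed: "p XOR m \<in> N" if "p \<in> V" "p \<notin> N" "m \<in> N" for p m
  proof -
    from that complement[of m] obtain z where "z \<in> N" "p = m XOR z" by auto
    then show ?thesis by (simp add: ac_simps)
  qed
  have both: "p XOR q \<notin> N" if "p \<in> V" "q \<in> V" "p \<notin> N" "q \<notin> N" for p q
  proof
    assume "p XOR q \<in> N"
    with mixed[OF that(1,3) this] that(4) show False by (simp add: ac_simps)
  qed
  show ?thesis
  proof (cases "x \<in> N"; cases "y \<in> N")
    assume "x \<in> N" "y \<in> N"
    then show ?thesis using N(1) by (simp add: xor_sum_free_def)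
  next
    assume "x \<in> N" "y \<notin> N"
    then show ?thesis using mixed[OF xy(2)] by (simp add: xor.commute)
  next
    assume "x \<notin> N" "y \<in> N"
    then show ?thesis using mixed[OF xy(1)] by simp
  next
    assume "x \<notin> N" "y \<notin> N"
    then show ?thesis using both xy by simp
  qed
qed

lemma functional_extending_half:
  assumes f: "xor_linear n f" and c: "c < 2 ^ n" "f c"
    and M: "xor_sum_free M" "M \<subseteq> {..<2 ^ n}"
      "2 * card (M \<inter> {x. x < 2 ^ n \<and> \<not> f x}) = card {x. x < 2 ^ n \<and> \<not> f x}"
  obtains g where "xor_linear n g" "\<And>x. x \<in> M \<Longrightarrow> g x"
proof -
  define V where "V = {x. x < 2 ^ n \<and> \<not> f x}"
  define N where "N = M \<inter> V"
  have VX: "x \<in> V \<longleftrightarrow> \<not> f x" if "x < 2 ^ n" for x using that by (simp add: V_def)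
  have half: "x XOR y \<in> N \<longleftrightarrow> (x \<in> N) \<noteq> (y \<in> N)" if "x \<in> V" "y \<in> V" for x y
  proof (rule xor_sum_free_half[OF _ _ _ _ _ that])
    show "finite V" by (simp add: V_def)
    show "p XOR q \<in> V" if "p \<in> V" "q \<in> V" for p q
      using xor_subgroup_kernel[OF f] that by (simp add: V_def xor_subgroup_def)
  qed (use M in \<open>auto simp: N_def V_def xor_sum_free_def\<close>)
  obtain m where m: "m < 2 ^ n" "f m" and mM: "m \<in> M \<or> M \<subseteq> V"
    using c M(2) VX by (metis lessThan_iff subsetD subsetI)
  define g where "g x = (if f x then x XOR m \<notin> N else x \<in> N)" for x
  have shift: "x XOR m \<in> V" if "x < 2 ^ n" "f x" for x
    using that m xor_linearD[OF f] by (simp add: V_def xor_less_power_two)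
  have "xor_linear n g"
    unfolding xor_linear_def
  proof (intro allI impI)
    fix x y :: nat assume xy: "x < 2 ^ n" "y < 2 ^ n"
    have eq: "(x XOR y) XOR m = (x XOR m) XOR y" "(x XOR y) XOR m = x XOR (y XOR m)"
      "x XOR y = (x XOR m) XOR (y XOR m)"
      by (simp_all add: ac_simps)
    consider "f x" "f y" | "f x" "\<not> f y" | "\<not> f x" "f y" | "\<not> f x" "\<not> f y" by blast
    then show "g (x XOR y) = (g x \<noteq> g y)"
    proof cases
      case 1
      then show ?thesis
        using half[OF shift[OF xy(1)] shift[OF xy(2)]] xor_linearD[OF f xy]
        by (simp add: g_def eq(3)[symmetric])
    next
      case 2
      then show ?thesis
        using half[OF shift[OF xy(1)], of y] xor_linearD[OF f xy] VX xy
        by (simp add: g_def eq(1))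
    next
      case 3
      then show ?thesis
        using half[of x, OF _ shift[OF xy(2)]] xor_linearD[OF f xy] VX xy
        by (auto simp: g_def eq(2))
    next
      case 4
      then show ?thesis
        using half[of x y] xor_linearD[OF f xy] VX xy by (simp add: g_def)
    qed
  qed
  moreover have "g x" if "x \<in> M" for x
  proof (cases "f x")
    case True
    have "x < 2 ^ n" using that M(2) by auto
    with True VX that mM have "m \<in> M" by blast
    with that M(1) True show ?thesis by (simp add: g_def N_def xor_sum_free_def)
  next
    case False
    then show ?thesis using that M(2) VX[of x] by (auto simp: g_def N_def)
  qed
  ultimately show thesis by (rule that)
qed

text \<open>
  In a subgroup of order eight, seven sum-free sets \<open>M b\<close> of at most four elements have to cover
  21 pairs, each using one of its elements for \<open>b\<close> itself, so nothing is covered twice.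
\<close>

lemma tight_in_order_eight:
  assumes V: "finite V" "card V = 8" "0 \<in> V" "\<And>x y. x \<in> V \<Longrightarrow> y \<in> V \<Longrightarrow> x XOR y \<in> V"
    and M: "\<And>b. b \<in> V - {0} \<Longrightarrow> xor_sum_free (M b)" "\<And>b. b \<in> V - {0} \<Longrightarrow> b \<in> M b"
      "\<And>a b. a \<in> V - {0} \<Longrightarrow> b \<in> V - {0} \<Longrightarrow> a \<noteq> b \<Longrightarrow> a XOR b \<in> M a \<union> M b"
  shows "b \<in> V - {0} \<Longrightarrow> card (M b \<inter> V) = 4"
    and "a \<in> V - {0} \<Longrightarrow> b \<in> V - {0} \<Longrightarrow> a \<noteq> b \<Longrightarrow> \<not> (a XOR b \<in> M a \<and> a XOR b \<in> M b)"
proof -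
  let ?W = "V - {0}"
  define t :: "nat \<Rightarrow> nat \<Rightarrow> nat" where "t a b = of_bool (a \<noteq> b \<and> a XOR b \<in> M a)" for a b
  have finW: "finite ?W" and cardW: "card ?W = 7" using V(1-3) by simp_all
  have t: "(\<Sum>b\<in>?W. t a b) = card (M a \<inter> V) - 1" if a: "a \<in> ?W" for a
  proof -
    have zero: "0 \<notin> M a" using M(1)[OF a] by (auto simp: xor_sum_free_def)
    let ?B = "?W \<inter> {b. a \<noteq> b \<and> a XOR b \<in> M a}"
    have "(\<Sum>b\<in>?W. t a b) = card ?B"
      unfolding t_def using finW by simp
    also have "?B = (\<lambda>e. a XOR e) ` (M a \<inter> V - {a})"
    proof (intro equalityI subsetI)
      fix b assume b: "b \<in> ?B"
      then have "a XOR b \<in> M a \<inter> V - {a}" using a V(4) by auto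
      then show "b \<in> (\<lambda>e. a XOR e) ` (M a \<inter> V - {a})"
        by (rule rev_image_eqI) simp
    next
      fix b assume "b \<in> (\<lambda>e. a XOR e) ` (M a \<inter> V - {a})"
      then obtain e where e: "e \<in> M a" "e \<in> V" "e \<noteq> a" "b = a XOR e" by blast
      moreover from zero e(1) have "e \<noteq> 0" by metis
      ultimately show "b \<in> ?B" using a V(4)[of a e] by simp
    qed
    also have "card \<dots> = card (M a \<inter> V - {a})" by (rule card_image[OF inj_xor])
    also have "\<dots> = card (M a \<inter> V) - 1"
      using M(2)[OF a] a by simp
    finally show ?thesis .
  qed
  have le4: "card (M a \<inter> V) \<le> 4" if "a \<in> ?W" for a
  proof -
    have "xor_sum_free (M a \<inter> V)" using M(1)[OF that] by (auto simp: xor_sum_free_def)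
    then have "2 * card (M a \<inter> V) \<le> card V"
      by (intro card_xor_sum_free V(1,4)) auto
    then show ?thesis using V(2) by simp
  qed
  have ge: "of_bool (a \<noteq> b) \<le> t a b + t b a" if "a \<in> ?W" "b \<in> ?W" for a b
    using M(3)[OF that] by (auto simp: t_def xor.commute)
  have double: "(\<Sum>a\<in>?W. \<Sum>b\<in>?W. t a b + t b a) = 2 * (\<Sum>a\<in>?W. card (M a \<inter> V) - 1)"
  proof -
    have "(\<Sum>a\<in>?W. \<Sum>b\<in>?W. t b a) = (\<Sum>a\<in>?W. \<Sum>b\<in>?W. t a b)" by (rule sum.swap)
    then show ?thesis using t by (simp add: sum.distrib)
  qed
  have off: "(\<Sum>a\<in>?W. \<Sum>b\<in>?W. of_bool (a \<noteq> b) :: nat) = 42"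
    by (simp only: sum_off_diagonal[OF finW] cardW)
  have lower: "42 \<le> (\<Sum>a\<in>?W. \<Sum>b\<in>?W. t a b + t b a)"
    unfolding off[symmetric] by (intro sum_mono ge)
  have upper: "(\<Sum>a\<in>?W. card (M a \<inter> V) - 1) \<le> (\<Sum>a\<in>?W. 3)"
    by (rule sum_mono) (use le4 in \<open>simp add: le_diff_conv\<close>)
  have eq21: "(\<Sum>a\<in>?W. card (M a \<inter> V) - 1) = (\<Sum>a\<in>?W. 3)"
    using lower upper cardW unfolding double by simp
  show "card (M b \<inter> V) = 4" if "b \<in> ?W" for b
  proof -
    have "card (M b \<inter> V) - 1 = 3"
      by (rule sum_mono_inv[OF eq21 _ that finW]) (use le4 in \<open>simp add: le_diff_conv\<close>)
    then show ?thesis by simp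
  qed
  show "\<not> (a XOR b \<in> M a \<and> a XOR b \<in> M b)" if ab: "a \<in> ?W" "b \<in> ?W" "a \<noteq> b" for a b
  proof -
    have "(\<Sum>a\<in>?W. \<Sum>b\<in>?W. of_bool (a \<noteq> b)) = (\<Sum>a\<in>?W. \<Sum>b\<in>?W. t a b + t b a)"
      using double eq21 off cardW by simp
    then have "(\<Sum>b\<in>?W. of_bool (a \<noteq> b)) = (\<Sum>b\<in>?W. t a b + t b a)"
      by (rule sum_mono_inv[OF _ _ ab(1) finW]) (intro sum_mono ge)
    then have "of_bool (a \<noteq> b) = t a b + t b a"
      by (rule sum_mono_inv[OF _ _ ab(2) finW]) (intro ge ab(1))
    then show ?thesis using ab(3) by (auto simp: t_def xor.commute)
  qed
qed

section \<open>Dimension four\<close>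

text \<open>
  Writing \<open>h(x) = g_x(c)\<close>, linearity and antisymmetry make \<open>h\<close> additive and give
  \<open>h(b) = h(b + c)\<close>; with the covering of \<open>c\<close> by \<open>b\<close> and \<open>b + c\<close> this makes \<open>h\<close> constantly 1.
\<close>

lemma no_functional_family:
  fixes c :: nat and g :: "nat \<Rightarrow> nat \<Rightarrow> bool"
  defines "P \<equiv> {x. x < 16 \<and> x \<noteq> 0 \<and> x \<noteq> c}"
  assumes c: "c < 16" "c \<noteq> 0"
    and linear: "\<And>b. b \<in> P \<Longrightarrow> xor_linear 4 (g b)" and diag: "\<And>b. b \<in> P \<Longrightarrow> g b b"
    and anti: "\<And>a b. a \<in> P \<Longrightarrow> b \<in> P \<Longrightarrow> b \<noteq> a \<Longrightarrow> b \<noteq> a XOR c \<Longrightarrow> g a b \<noteq> g b a"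
    and cover: "\<And>b. b \<in> P \<Longrightarrow> g b c \<or> g (b XOR c) c"
  shows False
proof -
  have less: "x XOR y < 16" if "x < 16" "y < 16" for x y :: nat
    using xor_less_power_two[of x 4 y] that by simp
  have lin: "g b (x XOR y) \<longleftrightarrow> g b x \<noteq> g b y" if "b \<in> P" "x < 16" "y < 16" for b x y
    using xor_linearD[OF linear[OF that(1)]] that by simp
  have PI: "x XOR y \<in> P" if "x < 16" "y < 16" "x \<noteq> y" "y \<noteq> x XOR c" for x y
    using that less by (auto simp: P_def)
  have P16: "x < 16" if "x \<in> P" for x using that by (simp add: P_def)
  have avoid: "\<exists>d<16. d \<notin> set xs" if "length xs < 16" for xs :: "nat list"
  proof -
    have "card (set xs) < card {..<16::nat}" using card_length[of xs] that by simp
    then show ?thesis by (metis card_mono finite_set lessThan_iff not_le subsetI)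
  qed
  have additive: "g (a XOR b) c \<longleftrightarrow> g a c \<noteq> g b c"
    if ab: "a \<in> P" "b \<in> P" "b \<noteq> a" "b \<noteq> a XOR c" for a b
  proof -
    obtain d where d: "d < 16" and "d \<notin> set [0, a, b, a XOR b, c, a XOR c, b XOR c, (a XOR b) XOR c]"
      using avoid[of "[0, a, b, a XOR b, c, a XOR c, b XOR c, (a XOR b) XOR c]"] by auto
    then have dn: "d \<noteq> 0" "d \<noteq> a" "d \<noteq> b" "d \<noteq> a XOR b" "d \<noteq> c" "d \<noteq> a XOR c" "d \<noteq> b XOR c"
      "d \<noteq> (a XOR b) XOR c" by simp_all
    define s where "s = a XOR b"
    define e where "e = d XOR c"
    have e: "e = x XOR c \<longleftrightarrow> d = x" "e = x \<longleftrightarrow> d = x XOR c" for x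
      unfolding e_def by (metis xor_cancel_left xor.commute)+
    have "s \<in> P" unfolding s_def using PI ab P16 by blast
    moreover have "d \<in> P" using d dn by (simp add: P_def)
    moreover have "e \<in> P"
      using d dn c(1) less[of d c] by (simp add: P_def e_def)
    ultimately have P: "s \<in> P" "d \<in> P" "e \<in> P" by simp_all
    have "g s e \<noteq> g e s" "g a e \<noteq> g e a" "g b e \<noteq> g e b" "g s d \<noteq> g d s" "g a d \<noteq> g d a"
      "g b d \<noteq> g d b"
      using anti[OF P(1,3)] anti[OF ab(1) P(3)] anti[OF ab(2) P(3)]
        anti[OF P(1,2)] anti[OF ab(1) P(2)] anti[OF ab(2) P(2)] dn
      by (simp_all add: e s_def)
    moreover have "g s e \<longleftrightarrow> g s d \<noteq> g s c" "g a e \<longleftrightarrow> g a d \<noteq> g a c" "g b e \<longleftrightarrow> g b d \<noteq> g b c"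
      "g e s \<longleftrightarrow> g e a \<noteq> g e b" "g d s \<longleftrightarrow> g d a \<noteq> g d b"
      using lin P ab(1,2) P16 d c(1) by (simp_all add: e_def s_def)
    ultimately show ?thesis unfolding s_def[symmetric] by argo
  qed
  have const: "g b c" if b: "b \<in> P" for b
  proof -
    obtain x where x: "x < 16" and "x \<notin> set [0, b, c, b XOR c]"
      using avoid[of "[0, b, c, b XOR c]"] by auto
    then have xn: "x \<noteq> 0" "x \<noteq> b" "x \<noteq> c" "x \<noteq> b XOR c" by simp_all
    define e where "e = b XOR c"
    define y where "y = x XOR b"
    have bx: "b \<noteq> x XOR c" using xn by (metis xor_cancel_right)
    have ye: "y \<noteq> e"
    proof
      assume "y = e"
      then have "x XOR b = c XOR b" by (simp add: y_def e_def xor.commute)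
      then show False using xn by (metis xor_cancel_right)
    qed
    have yb: "b \<noteq> y" using xn by (simp add: y_def)
    have yc: "b \<noteq> y XOR c"
    proof
      assume "b = y XOR c"
      then have "y = e" by (simp add: e_def)
      then show False using ye by simp
    qed
    have "x \<in> P" using x xn by (simp add: P_def)
    moreover have "e \<in> P" using b c less by (simp add: P_def e_def)
    moreover have "y \<in> P" unfolding y_def using PI[of x b] x xn bx P16[OF b] by simp
    ultimately have P: "x \<in> P" "e \<in> P" "y \<in> P" by simp_all
    have "x \<noteq> e" "x \<noteq> e XOR c" "y \<noteq> e XOR c" using xn yb by (simp_all add: e_def)
    then have "g e x \<noteq> g x e" "g x b \<noteq> g b x" "g e y \<noteq> g y e" "g y b \<noteq> g b y"
      using anti[OF P(2,1)] anti[OF P(1) b] anti[OF P(2,3)] anti[OF P(3) b] xn bx ye yb yc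
      by simp_all
    moreover have "g x e \<longleftrightarrow> g x b \<noteq> g x c" "g y e \<longleftrightarrow> g y b \<noteq> g y c" "g e e \<longleftrightarrow> g e b \<noteq> g e c"
      "g e y \<longleftrightarrow> g e x \<noteq> g e b" "g b y \<longleftrightarrow> g b x \<noteq> g b b"
      using lin P b P16 x c by (simp_all add: e_def y_def)
    moreover have "g y c \<longleftrightarrow> g x c \<noteq> g b c"
      unfolding y_def using additive[OF P(1) b] xn bx by simp
    moreover have "g b b" "g e e" "g b c \<or> g e c"
      using diag b P cover[OF b] by (simp_all add: e_def)
    ultimately show ?thesis by argo
  qed
  obtain a where a: "a < 16" and "a \<notin> set [0, c]" using avoid[of "[0, c]"] by auto
  then have aP: "a \<in> P" by (simp add: P_def)
  obtain b where b: "b < 16" and "b \<notin> set [0, c, a, a XOR c]"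
    using avoid[of "[0, c, a, a XOR c]"] by auto
  then have bP: "b \<in> P" and ne: "b \<noteq> a" "b \<noteq> a XOR c" by (simp_all add: P_def)
  have "a XOR b \<in> P" using PI a b ne by simp
  then show False using additive[OF aP bP ne] const aP bP by blast
qed

lemma no_sum_free_family:
  fixes c :: nat and M :: "nat \<Rightarrow> nat set"
  defines "P \<equiv> {x. x < 16 \<and> x \<noteq> 0 \<and> x \<noteq> c}"
  assumes c: "c < 16" "c \<noteq> 0"
    and M: "\<And>b. b \<in> P \<Longrightarrow> M b \<subseteq> {..<16}" "\<And>b. b \<in> P \<Longrightarrow> xor_sum_free (M b)"
      "\<And>b. b \<in> P \<Longrightarrow> b \<in> M b"
    and cover: "\<And>a b. a \<in> P \<Longrightarrow> b \<in> P \<Longrightarrow> a \<noteq> b \<Longrightarrow> a XOR b \<in> M a \<union> M b"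
  shows False
proof -
  have less: "x XOR y < 16" if "x < 16" "y < 16" for x y :: nat
    using xor_less_power_two[of x 4 y] that by simp
  have kernel: "finite {x. x < 2 ^ 4 \<and> \<not> f x}" "card {x. x < 2 ^ 4 \<and> \<not> f x} = 8"
    "0 \<in> {x. x < 2 ^ 4 \<and> \<not> f x}"
    "\<And>x y. x \<in> {x. x < 2 ^ 4 \<and> \<not> f x} \<Longrightarrow> y \<in> {x. x < 2 ^ 4 \<and> \<not> f x} \<Longrightarrow>
      x XOR y \<in> {x. x < 2 ^ 4 \<and> \<not> f x}"
    "\<And>x. x \<in> {x. x < 2 ^ 4 \<and> \<not> f x} - {0} \<Longrightarrow> x \<in> P"
    if f: "xor_linear 4 f" "f c" for f
    using card_kernel[OF f(1) _ f(2)] xor_subgroup_kernel[OF f(1)] c f(2)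
    by (simp_all add: xor_subgroup_def P_def) auto
  have "\<exists>g. xor_linear 4 g \<and> (\<forall>x\<in>M b. g x)" if b: "b \<in> P" for b
  proof -
    have "xor_subgroup 4 {0, b}" "c \<notin> {0, b}" "c < 2 ^ 4"
      using b c by (auto simp: xor_subgroup_def P_def)
    then obtain f where f: "xor_linear 4 f" "\<And>w. w \<in> {0, b} \<Longrightarrow> \<not> f w" "f c"
      using separating_functional by metis
    let ?V = "{x. x < 2 ^ 4 \<and> \<not> f x}"
    have bV: "b \<in> ?V - {0}" using b f(2) by (simp add: P_def)
    have "card (M b \<inter> ?V) = 4"
      by (rule tight_in_order_eight(1)[where M = M, OF kernel(1-4)[OF f(1,3)] _ _ _ bV])
        (use M cover kernel(5)[OF f(1,3)] in blast)+
    then have "2 * card (M b \<inter> ?V) = card ?V" using kernel(2)[OF f(1,3)] by simp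
    moreover have "M b \<subseteq> {..<2 ^ 4}" "c < 2 ^ 4" using M(1)[OF b] c by simp_all
    ultimately obtain g where "xor_linear 4 g" "\<And>x. x \<in> M b \<Longrightarrow> g x"
      using functional_extending_half[OF f(1) _ f(3) M(2)[OF b]] by metis
    then show ?thesis by blast
  qed
  then obtain g where g: "\<And>b. b \<in> P \<Longrightarrow> xor_linear 4 (g b)"
    "\<And>b x. b \<in> P \<Longrightarrow> x \<in> M b \<Longrightarrow> g b x"
    by metis
  have lin: "g b (x XOR y) \<longleftrightarrow> g b x \<noteq> g b y" if "b \<in> P" "x < 16" "y < 16" for b x y
    using xor_linearD[OF g(1)[OF that(1)]] that by simp
  have P16: "x < 16" if "x \<in> P" for x using that by (simp add: P_def)
  have "g a b \<noteq> g b a" if ab: "a \<in> P" "b \<in> P" "b \<noteq> a" "b \<noteq> a XOR c" for a b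
  proof -
    let ?W = "{0, a, b, a XOR b}"
    have "c \<noteq> a XOR b" using ab(4) by (metis xor_cancel_left)
    then have "xor_subgroup 4 ?W" "c \<notin> ?W" "c < 2 ^ 4"
      using ab c less by (auto simp: xor_subgroup_def P_def ac_simps)
    then obtain f where f: "xor_linear 4 f" "\<And>w. w \<in> ?W \<Longrightarrow> \<not> f w" "f c"
      using separating_functional by metis
    let ?V = "{x. x < 2 ^ 4 \<and> \<not> f x}"
    have abV: "a \<in> ?V - {0}" "b \<in> ?V - {0}" using ab f(2) by (simp_all add: P_def)
    let ?M = "\<lambda>b. {x. x < 16 \<and> g b x}"
    have sub: "M p \<subseteq> ?M p" if "p \<in> P" for p using g(2) M(1) that by blast
    have "\<not> (a XOR b \<in> ?M a \<and> a XOR b \<in> ?M b)"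
    proof (rule tight_in_order_eight(2)[where M = ?M, OF kernel(1-4)[OF f(1,3)] _ _ _ abV])
      show "xor_sum_free (?M p)" if "p \<in> ?V - {0}" for p
        using lin[OF kernel(5)[OF f(1,3) that]] by (simp add: xor_sum_free_def)
      show "p \<in> ?M p" if "p \<in> ?V - {0}" for p
        using sub M(3) kernel(5)[OF f(1,3) that] by blast
      show "p XOR q \<in> ?M p \<union> ?M q" if "p \<in> ?V - {0}" "q \<in> ?V - {0}" "p \<noteq> q" for p q
        using sub cover kernel(5)[OF f(1,3)] that by blast
      show "a \<noteq> b" using ab(3) by simp
    qed
    moreover have "a XOR b \<in> ?M a \<union> ?M b" using sub cover[OF ab(1,2)] ab by blast
    moreover have "g a a" "g b b" using g(2) M(3) ab by blast+
    ultimately show ?thesis using lin[OF ab(1), of a b] lin[OF ab(2), of a b] ab P16 less by auto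
  qed
  moreover have "g b c \<or> g (b XOR c) c" if b: "b \<in> P" for b
  proof -
    have bc: "b XOR c \<in> P" "b \<noteq> b XOR c" using b c less by (auto simp: P_def)
    have "c \<in> M b \<union> M (b XOR c)" using cover[OF b bc] by simp
    then show ?thesis using g(2) b bc by blast
  qed
  moreover have "g b b" if "b \<in> P" for b using g(2) M(3) that by blast
  ultimately show False
    using no_functional_family[OF c, of g] g(1) unfolding P_def by blast
qed

lemma gaps_empty_if_large:
  assumes "A \<subseteq> {..<2 ^ n}" "2 ^ n < 2 * card A"
  shows "gaps n A = {}"
proof (rule ccontr)
  assume "gaps n A \<noteq> {}"
  then obtain e where e: "e < 2 ^ n" "\<forall>u\<in>A. u XOR e \<notin> A" by (auto simp: gaps_def)
  let ?B = "(\<lambda>x. e XOR x) ` A"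
  have "A \<inter> ?B = {}" using e(2) by (auto simp: xor.commute)
  moreover have "A \<union> ?B \<subseteq> {..<2 ^ n}" using assms(1) e(1) xor_less_power_two by auto
  moreover have "finite A" using assms(1) finite_subset by blast
  ultimately have "card A + card ?B \<le> 2 ^ n"
    using card_mono[of "{..<2 ^ n}" "A \<union> ?B"] by (simp add: card_Un_disjoint)
  then show False using assms(2) by (simp add: card_image[OF inj_xor])
qed

text \<open>
  If \<open>x\<close>, \<open>y\<close> and their sum all were gaps, the translates of \<open>A\<close> by the subgroup
  generated by \<open>x\<close> and \<open>y\<close> would be disjoint.
\<close>

lemma xor_sum_free_gaps:
  assumes A: "A \<subseteq> {..<2 ^ n}" "2 ^ n < 4 * card A"
  shows "xor_sum_free (gaps n A)"
  unfolding xor_sum_free_def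
proof (intro ballI notI)
  fix x y assume xy: "x \<in> gaps n A" "y \<in> gaps n A" "x XOR y \<in> gaps n A"
  define K where "K = {0, x, y, x XOR y}"
  have K: "p XOR q \<in> gaps n A" if "p \<in> K" "q \<in> K" "p \<noteq> q" for p q
    using that xy by (auto simp: K_def ac_simps)
  have "x < 2 ^ n" "y < 2 ^ n" "x XOR y < 2 ^ n" "x \<noteq> 0" "y \<noteq> 0" "x \<noteq> y"
    using xy by (auto simp: gaps_def)
  then have card_K: "card K = 4" and K_less: "\<And>k. k \<in> K \<Longrightarrow> k < 2 ^ n" by (auto simp: K_def)
  have inj: "p = q \<and> u = v"
    if pq: "p \<in> K" "u \<in> A" "q \<in> K" "v \<in> A" "p XOR u = q XOR v" for p u q v
  proof -
    have "v = q XOR (p XOR u)" using pq(5) by simp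
    then have v: "u XOR (p XOR q) = v" by (simp add: ac_simps)
    have "p = q" using K[OF pq(1,3)] pq(2,4) v by (auto simp: gaps_def)
    with v show ?thesis by simp
  qed
  have "inj_on (\<lambda>(k, u). k XOR u) (K \<times> A)"
    by (rule inj_onI) (use inj in auto)
  then have "card ((\<lambda>(k, u). k XOR u) ` (K \<times> A)) = 4 * card A"
    by (simp only: card_image card_cartesian_product card_K)
  moreover have "(\<lambda>(k, u). k XOR u) ` (K \<times> A) \<subseteq> {..<2 ^ n}"
    using K_less A(1) xor_less_power_two by auto
  then have "card ((\<lambda>(k, u). k XOR u) ` (K \<times> A)) \<le> card {..<2 ^ n :: nat}"
    by (intro card_mono) simp_all
  ultimately show False using A(2) by simp
qed

lemma admissible_translate:
  assumes A: "admissible n A" and a: "a < 2 ^ n"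
  shows "admissible n (\<lambda>b. A (a XOR b))"
    and "(\<Sum>b<2 ^ n. card (A (a XOR b))) = (\<Sum>b<2 ^ n. card (A b))"
proof -
  have "(a XOR x) XOR (a XOR y) = x XOR y" for x y by (simp add: ac_simps)
  moreover have "a XOR x \<noteq> a XOR y" if "x \<noteq> y" for x y using that by (metis xor_cancel_left)
  ultimately show "admissible n (\<lambda>b. A (a XOR b))"
    using A xor_less_power_two[OF a] unfolding admissible_def by metis
  show "(\<Sum>b<2 ^ n. card (A (a XOR b))) = (\<Sum>b<2 ^ n. card (A b))"
    by (rule sum.reindex_bij_betw[OF bij_betw_xor[OF a]])
qed

lemma admissible_4_large_at_0:
  assumes A: "admissible 4 A" and large: "8 < card (A 0)"
  shows "(\<Sum>a<2 ^ 4. card (A a)) \<le> 128"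
proof (rule ccontr)
  assume "\<not> ?thesis"
  then have big: "128 < (\<Sum>a<16. card (A a))" by simp
  have sub: "A a \<subseteq> {..<2 ^ 4}" if "a < 16" for a using A that by (simp add: admissible_def)
  have cov: "a XOR b \<in> gaps 4 (A a) \<union> gaps 4 (A b)" if "a < 16" "b < 16" "a \<noteq> b" for a b
    using A that by (simp add: admissible_def)
  have "gaps 4 (A 0) = {}" by (rule gaps_empty_if_large) (use sub large in simp_all)
  then have self: "b \<in> gaps 4 (A b)" if "b < 16" "b \<noteq> 0" for b
    using cov[of 0 b] that by simp
  have le8: "card (A b) \<le> 8" if "b < 16" "b \<noteq> 0" for b
    using gaps_empty_if_large[of "A b" 4] sub[OF that(1)] self[OF that] by fastforce
  have small: "\<not> (card (A x) \<le> 4 \<and> card (A y) \<le> 4)"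
    if xy: "x < 16" "y < 16" "x \<noteq> 0" "y \<noteq> 0" "x \<noteq> y" for x y
  proof
    assume le4: "card (A x) \<le> 4 \<and> card (A y) \<le> 4"
    let ?R = "{..<16} - {0} - {x} - {y}"
    have "card ?R = 13" using xy by simp
    moreover have "(\<Sum>a\<in>?R. card (A a)) \<le> (\<Sum>a\<in>?R. 8)" by (intro sum_mono le8) auto
    ultimately have "(\<Sum>a\<in>?R. card (A a)) \<le> 104" by simp
    moreover have "(\<Sum>a<16. card (A a)) =
        card (A 0) + (card (A x) + (card (A y) + (\<Sum>a\<in>?R. card (A a))))"
      using xy by (simp add: sum.remove[of _ 0] sum.remove[of _ x] sum.remove[of _ y])
    moreover have "card (A 0) \<le> 16" using card_mono[OF _ sub[of 0]] by simp
    ultimately show False using le4 big by linarith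
  qed
  obtain c where c: "c < 16" "c \<noteq> 0" and ge5: "\<And>b. b < 16 \<Longrightarrow> b \<noteq> 0 \<Longrightarrow> b \<noteq> c \<Longrightarrow> 4 < card (A b)"
  proof (cases "\<exists>c<16. c \<noteq> 0 \<and> card (A c) \<le> 4")
    case True
    with small that show ?thesis by (metis not_le)
  next
    case False
    with that[of 1] show ?thesis by force
  qed
  show False
  proof (rule no_sum_free_family[OF c, of "\<lambda>b. gaps 4 (A b)"])
    show "xor_sum_free (gaps 4 (A b))" if "b \<in> {x. x < 16 \<and> x \<noteq> 0 \<and> x \<noteq> c}" for b
      using xor_sum_free_gaps[of "A b" 4] sub ge5[of b] that by simp
  qed (use self cov in \<open>auto simp: gaps_def\<close>)
qed

lemma admissible_4_sum_card_le:
  assumes A: "admissible 4 A"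
  shows "(\<Sum>a<2 ^ 4. card (A a)) \<le> 128"
proof (cases "\<exists>a<16. 8 < card (A a)")
  case True
  then obtain a where "a < 2 ^ 4" "8 < card (A (a XOR 0))" by auto
  then show ?thesis
    using admissible_4_large_at_0 admissible_translate[OF A] by metis
next
  case False
  then have "(\<Sum>a<16. card (A a)) \<le> (\<Sum>a<16::nat. 8)"
    by (intro sum_mono) (meson lessThan_iff not_le)
  then show ?thesis by simp
qed

section \<open>Extremal families\<close>

text \<open>
  Fibre \<open>a\<close> is the kernel of the functional with coefficient vector \<open>masks ! a\<close>. Both lists were found
  by a computer search.
\<close>

definition masks_3 :: "nat list" where
  "masks_3 = [0, 1, 3, 6, 7, 4, 5, 2]"

definition masks_4 :: "nat list" where
  "masks_4 = [1, 1, 3, 3, 7, 7, 13, 13, 15, 15, 9, 9, 11, 11, 5, 5]"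

lemma masks_3_cover:
  "\<forall>a\<in>set [0..<8]. \<forall>b\<in>set [0..<8]. a \<noteq> b \<longrightarrow>
     odd_and (masks_3 ! a) (a XOR b) \<or> odd_and (masks_3 ! b) (a XOR b)"
  "\<forall>a\<in>set [1..<8]. odd_and (masks_3 ! a) a"
  by code_simp+

lemma masks_4_cover:
  "\<forall>a\<in>set [0..<16]. \<forall>b\<in>set [0..<16]. a \<noteq> b \<longrightarrow>
     odd_and (masks_4 ! a) (a XOR b) \<or> odd_and (masks_4 ! b) (a XOR b)"
  "\<forall>a\<in>set [0..<16]. \<exists>c\<in>set [0..<16]. odd_and (masks_4 ! a) c"
  by code_simp+

lemma card_hyperplane:
  assumes "c < 2 ^ n" "odd_and m c"
  shows "2 * card {u. u < 2 ^ n \<and> \<not> odd_and m u} = 2 ^ n"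
  using card_kernel[of n "odd_and m" c] assms by (simp add: xor_linear_def odd_and_xor)

text \<open>Restricting the functionals for \<open>n = 3\<close> to a smaller cube keeps all their properties.\<close>

lemma r_ap_4_4_le_3:
  assumes "n \<le> 3" "2 * N + 2 ^ n * (2 ^ n - 1) = 2 * (2 ^ n * 2 ^ n)"
  shows "r_ap 4 4 n = N"
proof -
  let ?A = "\<lambda>a. {u. u < 2 ^ n \<and> \<not> odd_and (masks_3 ! a) u}"
  have "(2::nat) ^ n \<le> 2 ^ 3" using assms(1) by (rule power_increasing) simp
  then have le8: "(2::nat) ^ n \<le> 8" by simp
  have adm: "admissible n ?A"
    by (rule admissible_hyperplanes) (use masks_3_cover(1) le8 in auto)
  have "2 * (\<Sum>a<2 ^ n. card (?A a)) = 2 * card (?A 0) + (\<Sum>a\<in>{..<2 ^ n} - {0}. 2 * card (?A a))"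
    by (simp add: sum.remove[of _ 0] sum_distrib_left)
  also have "(\<Sum>a\<in>{..<2 ^ n} - {0}. 2 * card (?A a)) = (\<Sum>a\<in>{..<2 ^ n :: nat} - {0}. 2 ^ n)"
    by (rule sum.cong) (use masks_3_cover(2) le8 in \<open>auto intro!: card_hyperplane\<close>)
  also have "?A 0 = {..<2 ^ n}" by (auto simp: masks_3_def odd_and_def)
  finally have "2 * (\<Sum>a<2 ^ n. card (?A a)) = 2 * 2 ^ n + (2 ^ n - 1) * 2 ^ n" by simp
  moreover have "2 * (2 ^ n * 2 ^ n) = 2 * 2 ^ n + 2 * ((2 ^ n - 1) * (2 ^ n :: nat))"
    by (simp add: algebra_simps)
  ultimately have "(\<Sum>a<2 ^ n. card (?A a)) = N"
    using assms(2) by (simp add: mult.commute)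
  moreover have "(\<Sum>a<2 ^ n. card (A a)) \<le> N" if "admissible n A" for A
    using admissible_sum_card_le[OF that] assms(2) by linarith
  ultimately show ?thesis using adm r_ap_eqI by blast
qed

lemma r_ap_4_4_4: "r_ap 4 4 4 = 128"
proof (rule r_ap_eqI[OF admissible_4_sum_card_le])
  let ?A = "\<lambda>a. {u. u < 2 ^ 4 \<and> \<not> odd_and (masks_4 ! a) u}"
  show "admissible 4 ?A"
    by (rule admissible_hyperplanes) (use masks_4_cover(1) in auto)
  have "card (?A a) = 8" if "a < 16" for a
  proof -
    from that have "a \<in> set [0..<16]" by simp
    then obtain c where "c \<in> set [0..<16]" "odd_and (masks_4 ! a) c"
      using masks_4_cover(2) by blast
    then show ?thesis using card_hyperplane[of c 4] by simp
  qed
  then show "(\<Sum>a<2 ^ 4. card (?A a)) = 128" by simp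
qed

theorem theorem3p5:
  shows "r_ap 4 4 1 = 3 \<and> r_ap 4 4 2 = 10 \<and> r_ap 4 4 3 = 36 \<and> r_ap 4 4 4 = 128"
  using r_ap_4_4_le_3[of 1 3] r_ap_4_4_le_3[of 2 10] r_ap_4_4_le_3[of 3 36] r_ap_4_4_4 by simp

end
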